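(* (i) For any odd prime $p$, $$\det\left[\frac{\left(\frac{i+j}{p}\right)}{i+j}\right]_{1\leqslant i,j\leqslant (p-1)/2}\equiv\begin{cases}\left(\frac 2p\right)\pmod p&\text{if }p\equiv1\pmod 4,\\ \left(\frac{p-1}{2}\right)!\pmod p&\text{if }p\equiv 3\pmod 4.\end{cases}$$ (ii) For any prime $p\equiv 3\pmod 4$, $$\det\left[\frac{1}{i^2+j^2}\right]_{1\leqslant i,j\leqslant (p-1)/2}\equiv\left(\frac 2p\right)\pmod p.$$
   Context: $\left(\frac{\cdot}{p}\right)$ denotes the Legendre symbol modulo $p$. The determinants are rational numbers whose denominators are not divisible by $p$, and congruences modulo $p$ are understood in the ring of rationals with denominator prime to $p$. $\det[a_{ij}]_{1\leqslant i,j\leqslant n}$ denotes the determinant of the $n\times n$ matrix with entries $a_{ij}$. *)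

theory Defs
  imports
    "HOL-Number_Theory.Number_Theory"
    "Jordan_Normal_Form.Determinant"
begin

text \<open>The ring of rational numbers whose denominator (in lowest terms) is prime to \<open>p\<close>.\<close>

definition rat_prime_to :: "nat \<Rightarrow> rat set" where
  "rat_prime_to p = {x. coprime (snd (quotient_of x)) (int p)}"

text \<open>
  Congruence modulo the ideal generated by \<open>p\<close> in that ring. Membership of both sides is part
  of the relation, since in the field of rationals the ideal generated by \<open>p\<close> is everything.
\<close>

definition rat_cong :: "rat \<Rightarrow> rat \<Rightarrow> nat \<Rightarrow> bool" where
  "rat_cong x y p \<longleftrightarrow>
     x \<in> rat_prime_to p \<and> y \<in> rat_prime_to p \<and>
     (\<exists>z \<in> rat_prime_to p. x - y = of_nat p * z)"

text \<open>
  The determinant of \<open>a i j\<close> for \<open>1 \<le> i, j \<le> n\<close>; matrices in the library are indexed from 0.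
\<close>

definition det_from_1 :: "nat \<Rightarrow> (nat \<Rightarrow> nat \<Rightarrow> rat) \<Rightarrow> rat" where
  "det_from_1 n a = det (mat n n (\<lambda>(i, j). a (Suc i) (Suc j)))"

end

theory Submission
  imports Defs
begin

text \<open>
  Let \<open>n = (p - 1) / 2\<close>. Modulo \<open>p\<close> both matrices have entries
  \<open>\<Sum>k<n. c k * x i ^ k * y j ^ (n - 1 - k)\<close>, so they factor into a Vandermonde matrix, a
  diagonal matrix and a reversed Vandermonde matrix.

  In (i), Euler's criterion turns the entry into \<open>(i + j) ^ (n - 1)\<close>, and the determinant is
  \<open>(- 1) ^ (n div 2) * fact (n - 1) ^ n\<close>. In (ii), \<open>n\<close> is odd and \<open>x = i\<^sup>2\<close>, \<open>y = j\<^sup>2\<close> satisfy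
  \<open>x ^ n = y ^ n = 1\<close>, so that \<open>2 / (x + y) = (x ^ n + y ^ n) / (x + y)\<close> is a polynomial, and the
  determinant is \<open>2 ^ (- n)\<close> times the square of the Vandermonde product of the \<open>i\<^sup>2\<close>. The
  values modulo \<open>p\<close> then follow from Wilson's theorem in the form
  \<open>k! (p - 1 - k)! = (- 1) ^ (k + 1)\<close> and from the value of the Legendre symbol of 2.
\<close>

section \<open>Vandermonde determinants\<close>

text \<open>
  Coefficients of \<open>z ^ k\<close> in the Newton basis \<open>\<Prod>m<l. z - x m\<close>; the recursion comes from
  \<open>z = (z - x l) + x l\<close>.
\<close>

primrec newton_coeff :: "(nat \<Rightarrow> 'a::comm_ring_1) \<Rightarrow> nat \<Rightarrow> nat \<Rightarrow> 'a" where
  "newton_coeff x 0 = (\<lambda>l. if l = 0 then 1 else 0)"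
| "newton_coeff x (Suc k) =
     (\<lambda>l. x l * newton_coeff x k l + (if l = 0 then 0 else newton_coeff x k (l - 1)))"

lemma newton_coeff_eq_0: "k < l \<Longrightarrow> newton_coeff x k l = 0"
  by (induction k arbitrary: l) auto

lemma newton_coeff_same: "newton_coeff x k k = 1"
  by (induction k) (auto simp: newton_coeff_eq_0)

lemma power_newton_expansion:
  fixes x :: "nat \<Rightarrow> 'a::comm_ring_1"
  shows "z ^ k = (\<Sum>l\<le>k. newton_coeff x k l * (\<Prod>m<l. z - x m))"
proof (induction k)
  case (Suc k)
  let ?N = "\<lambda>l. \<Prod>m<l. z - x m"
  have "z ^ Suc k = (\<Sum>l\<le>k. newton_coeff x k l * (z * ?N l))"
    by (simp add: Suc.IH sum_distrib_left ac_simps)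
  also have "\<dots> = (\<Sum>l\<le>k. x l * newton_coeff x k l * ?N l + newton_coeff x k l * ?N (Suc l))"
    by (intro sum.cong) (auto simp: algebra_simps)
  \<comment> \<open>Both sums get the range up to \<open>Suc k\<close>: in the first the new top
    term vanishes, in the second the index is shifted by one and padded with 0.\<close>
  also have "\<dots> = (\<Sum>l\<le>Suc k. x l * newton_coeff x k l * ?N l)
      + (\<Sum>l\<le>Suc k. (if l = 0 then 0 else newton_coeff x k (l - 1)) * ?N l)"
    by (subst (2) sum.atMost_Suc_shift) (simp add: sum.distrib newton_coeff_eq_0)
  also have "\<dots> = (\<Sum>l\<le>Suc k. newton_coeff x (Suc k) l * ?N l)"
    unfolding sum.distrib [symmetric] by (simp only: newton_coeff.simps distrib_right)
  finally show ?case .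
qed simp

text \<open>The change from the Newton basis to monomials is unitriangular, and the Newton
  polynomial of degree l vanishes at \<open>x i\<close> for i < l. This is an LU factorization whose
  diagonal gives the product.\<close>

lemma det_vandermonde:
  fixes x :: "nat \<Rightarrow> 'a::idom"
  shows "det (mat n n (\<lambda>(i, k). x i ^ k)) = (\<Prod>i<n. \<Prod>m<i. x i - x m)"
proof -
  define L where "L = mat n n (\<lambda>(i, l). \<Prod>m<l. x i - x m)"
  define U where "U = mat n n (\<lambda>(l, k). newton_coeff x k l)"
  have [simp]: "L \<in> carrier_mat n n" "U \<in> carrier_mat n n"
    by (simp_all add: L_def U_def)
  have "x i ^ k = (\<Sum>l = 0..<n. (\<Prod>m<l. x i - x m) * newton_coeff x k l)" if "k < n" for i k
    unfolding power_newton_expansion [of "x i" k x]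
    using that by (intro sum.mono_neutral_cong_left) (auto simp: newton_coeff_eq_0)
  then have "mat n n (\<lambda>(i, k). x i ^ k) = L * U"
    by (intro eq_matI) (auto simp: L_def U_def scalar_prod_def)
  then have "det (mat n n (\<lambda>(i, k). x i ^ k)) = det L * det U"
    by (simp add: det_mult [of _ n])
  also have "det L = (\<Prod>i<n. \<Prod>m<i. x i - x m)"
    by (subst det_lower_triangular [of n])
       (auto simp: L_def prod_list_diag_prod atLeast0LessThan intro!: prod.cong)
  also have "det U = 1"
    by (subst det_upper_triangular [of _ n])
       (auto simp: U_def prod_list_diag_prod newton_coeff_eq_0 newton_coeff_same)
  finally show ?thesis
    by simp
qed

text \<open>The same permutation acts on rows and on columns, so its sign enters squared. The column
  action is a row action on the transpose.\<close>

lemma det_reverse_rows_cols: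
  fixes f :: "nat \<Rightarrow> nat \<Rightarrow> 'a::comm_ring_1"
  shows "det (mat n n (\<lambda>(i, j). f (n - Suc i) (n - Suc j))) = det (mat n n (\<lambda>(i, j). f i j))"
proof -
  define r where "r i = (if i < n then n - Suc i else i)" for i
  have r: "r permutes {0..<n}"
    by (rule bij_imp_permutes, rule bij_betw_byWitness [where f' = r]) (auto simp: r_def)
  let ?A = "mat n n (\<lambda>(i, j). f i j)"
  have "det (mat n n (\<lambda>(i, j). f (n - Suc i) (n - Suc j))) =
      det (transpose_mat (mat n n (\<lambda>(i, j). f (n - Suc i) (n - Suc j))))"
    by (rule det_transpose [symmetric, of _ n]) simp
  also have "transpose_mat (mat n n (\<lambda>(i, j). f (n - Suc i) (n - Suc j))) =
      mat n n (\<lambda>(i, j). transpose_mat (mat n n (\<lambda>(i, j). ?A $$ (r i, j))) $$ (r i, j))"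
    by (intro eq_matI) (auto simp: r_def)
  also have "det \<dots> = signof r * (signof r * det ?A)"
    by (simp add: det_permute_rows [OF _ r] det_transpose [of _ n])
  also have "\<dots> = det ?A"
    by (simp add: sign_def)
  finally show ?thesis .
qed

text \<open>Reversing the rows alone would cost a sign. Reversing the columns as well costs none and
  merely lists the points backwards.\<close>

lemma det_vandermonde_reversed:
  fixes y :: "nat \<Rightarrow> 'a::idom"
  shows "det (mat n n (\<lambda>(k, j). y j ^ (n - Suc k))) = (\<Prod>i<n. \<Prod>m<i. y m - y i)"
proof -
  have "det (mat n n (\<lambda>(k, j). y j ^ (n - Suc k))) =
      det (mat n n (\<lambda>(k, j). (\<lambda>k j. y (n - Suc j) ^ k) (n - Suc k) (n - Suc j)))"
    by (intro arg_cong [of _ _ det] eq_matI) auto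
  also have "\<dots> = det (mat n n (\<lambda>(k, j). y (n - Suc j) ^ k))"
    by (subst det_reverse_rows_cols) simp
  also have "\<dots> = det (transpose_mat (mat n n (\<lambda>(i, k). y (n - Suc i) ^ k)))"
    by (intro arg_cong [of _ _ det] eq_matI) auto
  also have "\<dots> = (\<Prod>i<n. \<Prod>m<i. y (n - Suc i) - y (n - Suc m))"
    by (subst det_transpose [of _ n]) (simp_all add: det_vandermonde)
  also have "\<dots> = (\<Prod>(i, m)\<in>(SIGMA i:{..<n}. {..<i}). y (n - Suc i) - y (n - Suc m))"
    by (subst prod.Sigma) auto
  \<comment> \<open>Listing backwards exchanges the larger and the smaller index of a pair; this map
    is an involution, hence both witnesses.\<close>
  also have "\<dots> = (\<Prod>(i, m)\<in>(SIGMA i:{..<n}. {..<i}). y m - y i)"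
    by (rule prod.reindex_bij_witness [where
          i = "\<lambda>(i, m). (n - Suc m, n - Suc i)" and j = "\<lambda>(i, m). (n - Suc m, n - Suc i)"]) auto
  also have "\<dots> = (\<Prod>i<n. \<Prod>m<i. y m - y i)"
    by (subst prod.Sigma) auto
  finally show ?thesis .
qed

text \<open>Both determinants are instances: \<open>c\<close> consists of binomial coefficients in
  (i) and is constant in (ii).\<close>

lemma det_homogeneous_sum:
  fixes x y c :: "nat \<Rightarrow> 'a::idom"
  shows "det (mat n n (\<lambda>(i, j). \<Sum>k<n. c k * x i ^ k * y j ^ (n - Suc k))) =
    (\<Prod>k<n. c k) * (\<Prod>i<n. \<Prod>m<i. x i - x m) * (\<Prod>i<n. \<Prod>m<i. y m - y i)"
proof -
  define V where "V = mat n n (\<lambda>(i, k). x i ^ k)"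
  define D where "D = mat n n (\<lambda>(i, k). if i = k then c k else 0)"
  define W where "W = mat n n (\<lambda>(k, j). y j ^ (n - Suc k))"
  have [simp]: "V \<in> carrier_mat n n" "D \<in> carrier_mat n n" "W \<in> carrier_mat n n"
    by (simp_all add: V_def D_def W_def)
  have "V * D = mat n n (\<lambda>(i, k). x i ^ k * c k)"
    by (intro eq_matI) (auto simp: V_def D_def scalar_prod_def if_distrib cong: if_cong)
  then have "mat n n (\<lambda>(i, j). \<Sum>k<n. c k * x i ^ k * y j ^ (n - Suc k)) = V * D * W"
    by (intro eq_matI)
       (auto simp: W_def scalar_prod_def atLeast0LessThan ac_simps intro!: sum.cong)
  then have "det (mat n n (\<lambda>(i, j). \<Sum>k<n. c k * x i ^ k * y j ^ (n - Suc k))) =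
      det V * det D * det W"
    by (simp add: det_mult [of _ n] mult_carrier_mat [of _ n n _ n])
  also have "det D = (\<Prod>k<n. c k)"
    by (subst det_upper_triangular [of _ n])
       (auto simp: D_def prod_list_diag_prod atLeast0LessThan intro!: prod.cong)
  finally show ?thesis
    by (simp add: V_def W_def det_vandermonde det_vandermonde_reversed ac_simps)
qed

section \<open>Congruences of rational numbers\<close>

text \<open>Reduction to lowest terms replaces \<open>b\<close> by one of its divisors. For
  \<open>b = 0\<close> the quotient is 0 by convention, with denominator 1.\<close>

lemma rat_prime_to_divide:
  assumes "coprime b (int p)"
  shows "of_int a / of_int b \<in> rat_prime_to p"
proof (cases "b = 0")
  case False
  obtain c d where q: "quotient_of (of_int a / of_int b) = (c, d)"
    by fastforce
  then have "rat_of_int a / of_int b = of_int c / of_int d" "d > 0" "coprime c d"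
    using quotient_of_div quotient_of_denom_pos quotient_of_coprime by auto
  then have "rat_of_int (a * d) = of_int (c * b)"
    using False by (simp add: field_simps)
  then have "a * d = c * b"
    by (simp only: of_int_eq_iff)
  then have "d dvd b"
    using \<open>coprime c d\<close> by (metis coprime_commute coprime_dvd_mult_right_iff dvd_triv_right)
  with assms have "coprime d (int p)"
    by (metis coprime_divisors dvd_refl)
  with q show ?thesis
    by (simp add: rat_prime_to_def)
qed (auto simp: rat_prime_to_def)

text \<open>Since any representing fraction will do, closure of the ring becomes plain fraction
  arithmetic.\<close>

lemma rat_prime_to_iff:
  "x \<in> rat_prime_to p \<longleftrightarrow> (\<exists>a b. x = of_int a / of_int b \<and> b \<noteq> 0 \<and> coprime b (int p))"
proof
  assume "x \<in> rat_prime_to p"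
  moreover obtain a b where "quotient_of x = (a, b)"
    by fastforce
  moreover from this have "x = of_int a / of_int b" "b > 0"
    using quotient_of_div quotient_of_denom_pos by auto
  ultimately show "\<exists>a b. x = of_int a / of_int b \<and> b \<noteq> 0 \<and> coprime b (int p)"
    by (auto simp: rat_prime_to_def)
qed (auto simp: rat_prime_to_divide)

lemma rat_prime_to_of_int [simp]: "of_int a \<in> rat_prime_to p"
  by (simp add: rat_prime_to_def)

lemma rat_prime_to_add:
  assumes "x \<in> rat_prime_to p" "y \<in> rat_prime_to p"
  shows "x + y \<in> rat_prime_to p"
proof -
  obtain a b c d where "x = of_int a / of_int b" "b \<noteq> 0" "coprime b (int p)"
    "y = of_int c / of_int d" "d \<noteq> 0" "coprime d (int p)"
    using assms by (auto simp: rat_prime_to_iff)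
  then have "x + y = of_int (a * d + c * b) / of_int (b * d)" "coprime (b * d) (int p)"
    by (simp_all add: add_frac_eq)
  then show ?thesis
    by (simp only: rat_prime_to_divide)
qed

lemma rat_prime_to_mult:
  assumes "x \<in> rat_prime_to p" "y \<in> rat_prime_to p"
  shows "x * y \<in> rat_prime_to p"
proof -
  obtain a b c d where "x = of_int a / of_int b" "coprime b (int p)"
    "y = of_int c / of_int d" "coprime d (int p)"
    using assms by (auto simp: rat_prime_to_iff)
  then have "x * y = of_int (a * c) / of_int (b * d)" "coprime (b * d) (int p)"
    by simp_all
  then show ?thesis
    by (simp only: rat_prime_to_divide)
qed

text \<open>The bridge from integer congruences: if a - b c = p k, then a / b - c = p (k /
  b).\<close>

lemma rat_cong_divide_of_int:
  assumes "[a = b * c] (mod int p)" "coprime b (int p)" "b \<noteq> 0"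
  shows "rat_cong (of_int a / of_int b) (of_int c) p"
proof -
  from assms(1) obtain k where "a - b * c = int p * k"
    by (auto simp: cong_iff_dvd_diff)
  then have "rat_of_int (a - b * c) = of_int (int p * k)"
    by simp
  with assms(3) have "of_int a / of_int b - of_int c = of_nat p * (of_int k / rat_of_int b)"
    by (simp add: field_simps)
  moreover have "of_int k / rat_of_int b \<in> rat_prime_to p" "of_int a / rat_of_int b \<in> rat_prime_to p"
    using assms(2) by (simp_all only: rat_prime_to_divide)
  ultimately show ?thesis
    using rat_prime_to_of_int [of c p] unfolding rat_cong_def by blast
qed

lemma rat_cong_of_int: "[a = b] (mod int p) \<Longrightarrow> rat_cong (of_int a) (of_int b) p"
  using rat_cong_divide_of_int [of a 1 b p] by simp

lemma rat_cong_refl: "x \<in> rat_prime_to p \<Longrightarrow> rat_cong x x p"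
  unfolding rat_cong_def by (intro conjI bexI [of _ "of_int 0"] rat_prime_to_of_int) simp_all

lemma rat_cong_add:
  assumes "rat_cong x x' p" "rat_cong y y' p"
  shows "rat_cong (x + y) (x' + y') p"
proof -
  obtain z w where "z \<in> rat_prime_to p" "x - x' = of_nat p * z"
    "w \<in> rat_prime_to p" "y - y' = of_nat p * w"
    using assms by (auto simp: rat_cong_def)
  then have "x + y - (x' + y') = of_nat p * (z + w)" "z + w \<in> rat_prime_to p"
    by (simp_all add: algebra_simps rat_prime_to_add)
  then show ?thesis
    using assms by (auto simp: rat_cong_def rat_prime_to_add)
qed

lemma rat_cong_mult:
  assumes "rat_cong x x' p" "rat_cong y y' p"
  shows "rat_cong (x * y) (x' * y') p"
proof -
  obtain z w where zw: "z \<in> rat_prime_to p" "x - x' = of_nat p * z"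
    "w \<in> rat_prime_to p" "y - y' = of_nat p * w"
    using assms by (auto simp: rat_cong_def)
  have "x * y - x' * y' = (x - x') * y + x' * (y - y')"
    by (simp add: algebra_simps)
  also have "\<dots> = of_nat p * (z * y + x' * w)"
    unfolding zw by (simp add: algebra_simps)
  finally show ?thesis
    using assms zw by (auto simp: rat_cong_def intro!: rat_prime_to_add rat_prime_to_mult)
qed

lemma rat_cong_trans [trans]:
  assumes "rat_cong x y p" "rat_cong y z p"
  shows "rat_cong x z p"
proof -
  obtain u v where "u \<in> rat_prime_to p" "x - y = of_nat p * u"
    "v \<in> rat_prime_to p" "y - z = of_nat p * v"
    using assms by (auto simp: rat_cong_def)
  then have "x - z = of_nat p * (u + v)" "u + v \<in> rat_prime_to p"
    by (simp_all add: algebra_simps rat_prime_to_add)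
  then show ?thesis
    using assms by (auto simp: rat_cong_def)
qed

lemma rat_cong_sum:
  assumes "\<And>i. i \<in> A \<Longrightarrow> rat_cong (f i) (g i) p"
  shows "rat_cong (sum f A) (sum g A) p"
  using assms
  by (induction A rule: infinite_finite_induct)
     (auto intro!: rat_cong_add rat_cong_refl simp: rat_prime_to_of_int [of 0, simplified])

lemma rat_cong_prod:
  assumes "\<And>i. i \<in> A \<Longrightarrow> rat_cong (f i) (g i) p"
  shows "rat_cong (prod f A) (prod g A) p"
  using assms
  by (induction A rule: infinite_finite_induct)
     (auto intro!: rat_cong_mult rat_cong_refl simp: rat_prime_to_of_int [of 1, simplified])

text \<open>By the Leibniz formula a determinant is an integer polynomial in its entries, so the
  entries may be reduced to integers first.\<close>

lemma rat_cong_det: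
  assumes "\<And>i j. i < n \<Longrightarrow> j < n \<Longrightarrow> rat_cong (f i j) (of_int (g i j)) p"
  shows "rat_cong (det (mat n n (\<lambda>(i, j). f i j))) (of_int (det (mat n n (\<lambda>(i, j). g i j)))) p"
proof -
  have "of_int (det (mat n n (\<lambda>(i, j). g i j))) =
      (\<Sum>\<pi> | \<pi> permutes {0..<n}. signof \<pi> * (\<Prod>i = 0..<n. rat_of_int (g i (\<pi> i))))"
    by (subst det_def' [of _ n])
       (auto simp: sign_def intro!: sum.cong prod.cong)
  moreover have "det (mat n n (\<lambda>(i, j). f i j)) =
      (\<Sum>\<pi> | \<pi> permutes {0..<n}. signof \<pi> * (\<Prod>i = 0..<n. f i (\<pi> i)))"
    by (subst det_def' [of _ n]) (auto intro!: sum.cong prod.cong)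
  ultimately show ?thesis
    using assms
    by (auto intro!: rat_cong_sum rat_cong_mult rat_cong_prod rat_cong_refl)
qed

section \<open>Factorials and the Legendre symbol of 2\<close>

text \<open>Starting from Wilson's theorem, each step trades the factor p - (k + 1) of one factorial
  for k + 1 in the other, which flips the sign modulo p.\<close>

lemma fact_mult_fact_cong:
  assumes "prime p" "k < p"
  shows "[fact k * fact (p - Suc k) = (- 1) ^ Suc k] (mod int p)"
  using assms(2)
proof (induction k)
  case 0
  then show ?case
    using wilson_theorem [OF assms(1)] by simp
next
  case (Suc k)
  let ?F = "fact (p - Suc (Suc k)) :: int"
  have "p - Suc k = Suc (p - Suc (Suc k))"
    using Suc.prems by simp
  then have "fact (p - Suc k) = (int p - int (Suc k)) * ?F"
    using Suc.prems by (simp add: of_nat_diff)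
  then have "fact k * fact (p - Suc k) = int p * (fact k * ?F) - fact (Suc k) * ?F"
    by (simp only: fact_Suc of_nat_mult of_nat_fact of_nat_Suc) (simp add: algebra_simps)
  with Suc have "[int p * (fact k * ?F) - fact (Suc k) * ?F = (- 1) ^ Suc k] (mod int p)"
    by simp
  moreover have "[int p * (fact k * ?F) - fact (Suc k) * ?F = - (fact (Suc k) * ?F)] (mod int p)"
    by (simp add: cong_iff_dvd_diff)
  ultimately have "[- (fact (Suc k) * ?F) = (- 1) ^ Suc k] (mod int p)"
    by (metis cong_sym cong_trans)
  then have "[- (- (fact (Suc k) * ?F)) = - ((- 1) ^ Suc k)] (mod int p)"
    by (simp only: cong_minus_minus_iff)
  then show ?case
    by (simp del: fact_Suc)
qed

lemma fact_half_square_cong: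
  assumes "prime p" "p = 2 * n + 1"
  shows "[(fact n)\<^sup>2 = (- 1) ^ Suc n] (mod int p)"
  using fact_mult_fact_cong [OF assms(1), of n] assms(2) by (simp add: power2_eq_square)

text \<open>Gauss's lemma: the doubles of 1, ..., n stay below p, so they are their own residues,
  and 2 x > n holds exactly when x > \<open>n div 2\<close>.\<close>

lemma Legendre_2:
  assumes "prime p" "p = 2 * n + 1"
  shows "Legendre 2 (int p) = (- 1) ^ (n - n div 2)"
proof -
  have "2 < p"
    using prime_ge_2_nat [OF assms(1)] assms(2) by presburger
  moreover have "\<not> int p dvd 2"
    using \<open>2 < p\<close> zdvd_imp_le by fastforce
  ultimately interpret GAUSS p 2
    using assms(1) by unfold_locales (auto simp: cong_0_iff)
  have half: "(int p - 1) div 2 = int n"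
    using assms(2) by simp
  have "x * 2 mod int p = x * 2" if "x \<in> A" for x
    using that assms(2) unfolding A_def half by (intro mod_pos_pos_trivial) auto
  then have "C = (\<lambda>x. x * 2) ` A"
    by (simp add: C_def B_def image_image)
  then have "E = (\<lambda>x. x * 2) ` {int (n div 2)<..int n}"
    unfolding E_def half by (auto simp: A_def half)
  then have "card E = card {int (n div 2)<..int n}"
    by (simp add: card_image inj_on_def)
  then have "card E = n - n div 2"
    by (simp add: nat_diff_distrib)
  then show ?thesis
    using gauss_lemma by simp
qed

section \<open>The two determinants\<close>

lemma prod_minus_one_power: "(\<Prod>i<n. (- 1) ^ i :: int) = (- 1) ^ (n div 2)"
proof (induction n)
  case (Suc n)
  show ?case
  proof (cases "even n")
    case True
    with Suc show ?thesis by simp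
  next
    case False
    with Suc show ?thesis by (simp add: odd_iff_mod_2_eq_one)
  qed
qed simp

lemma prod_diff_from_below: "(\<Prod>m<i. int i - int m) = fact i"
proof -
  have "(\<Prod>m<i. int i - int m) = (\<Prod>m = 0..<i. int (i - m))"
    by (intro prod.cong) (auto simp: of_nat_diff)
  then show ?thesis
    by (simp add: fact_prod_rev)
qed

text \<open>The binomial theorem supplies the coefficients, and differences of consecutive integers
  multiply to factorials. Then k! (n - 1 - k)! times the binomial coefficient is (n - 1)! for each
  of the n values of k.\<close>

lemma det_power_sum:
  "det (mat n n (\<lambda>(i, j). (int (Suc i) + int (Suc j)) ^ (n - 1))) =
    (- 1) ^ (n div 2) * fact (n - 1) ^ n"
proof (cases n)
  case (Suc n')
  let ?c = "\<lambda>k. int (n' choose k)"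
  have "(int (Suc i) + int (Suc j)) ^ (n - 1) =
      (\<Sum>k<n. ?c k * int (Suc i) ^ k * int (Suc j) ^ (n - Suc k))" for i j
    unfolding Suc binomial_ring by (intro sum.cong) auto
  then have "det (mat n n (\<lambda>(i, j). (int (Suc i) + int (Suc j)) ^ (n - 1))) =
      (\<Prod>k<n. ?c k) * (\<Prod>i<n. \<Prod>m<i. int (Suc i) - int (Suc m)) *
      (\<Prod>i<n. \<Prod>m<i. int (Suc m) - int (Suc i))"
    by (simp only: det_homogeneous_sum)
  \<comment> \<open>This product is written in reverse order so that its factorials complement those
    of the other one.\<close>
  also have "(\<Prod>i<n. \<Prod>m<i. int (Suc i) - int (Suc m)) = (\<Prod>i<n. fact (n - Suc i))"
    by (subst prod.nat_diff_reindex) (simp add: prod_diff_from_below)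
  also have "(\<Prod>i<n. \<Prod>m<i. int (Suc m) - int (Suc i)) = (\<Prod>i<n. (- 1) ^ i * fact i)"
  proof (intro prod.cong refl)
    show "(\<Prod>m<i. int (Suc m) - int (Suc i)) = (- 1) ^ i * fact i" for i
      using prod.distrib [of "\<lambda>_. - 1" "\<lambda>m. int i - int m" "{..<i}"]
      by (simp add: prod_diff_from_below)
  qed
  also have "(\<Prod>k<n. ?c k) * (\<Prod>i<n. fact (n - Suc i)) * (\<Prod>i<n. (- 1) ^ i * fact i) =
      (- 1) ^ (n div 2) * (\<Prod>k<n. fact k * fact (n' - k) * ?c k)"
    by (simp add: Suc prod.distrib prod_minus_one_power [of "Suc n'"] ac_simps del: prod.lessThan_Suc)
  also have "(\<Prod>k<n. fact k * fact (n' - k) * ?c k) = (\<Prod>k<n. fact n')"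
  proof (intro prod.cong refl)
    fix k assume "k \<in> {..<n}"
    then have "int (fact k * fact (n' - k) * (n' choose k)) = int (fact n')"
      by (subst binomial_fact_lemma) (auto simp: Suc)
    then show "fact k * fact (n' - k) * ?c k = fact n'"
      by simp
  qed
  finally show ?thesis
    by (simp add: Suc)
qed simp

text \<open>As 2 n = -1 modulo p, (n - 1)! becomes -2 n!. Euler's criterion evaluates 2^n, and the
  powers of n! collapse through its square; for odd n one n! is left over.\<close>

lemma det_power_sum_cong:
  assumes "prime p" "p = 2 * n + 1"
  shows "[(- 1) ^ (n div 2) * fact (n - 1) ^ n =
    (if even n then Legendre 2 (int p) else fact n)] (mod int p)"
proof -
  have n: "n > 0" "2 < p"
    using prime_ge_2_nat [OF assms(1)] assms(2) by presburger+
  let ?L = "Legendre 2 (int p)"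
  have L: "[2 ^ n = ?L] (mod int p)"
    using euler_criterion [OF assms(1) n(2), of 2] assms(2) by (simp add: cong_sym)
  have "fact n = int n * fact (n - 1)"
    using n by (simp add: fact_reduce)
  then have "fact (n - 1) - (- 2) * fact n = int p * fact (n - 1)"
    by (simp add: assms(2) algebra_simps)
  then have "[fact (n - 1) = (- 2) * fact n] (mod int p)"
    by (metis cong_iff_dvd_diff dvd_triv_left)
  then have "[fact (n - 1) ^ n = ((- 2) * fact n) ^ n] (mod int p)"
    by (rule cong_pow)
  also have "((- 2) * fact n) ^ n = (- 1) ^ n * (2 ^ n * fact n ^ n :: int)"
    by (simp only: power_mult_distrib [symmetric]) simp
  also have "[(- 1) ^ n * (2 ^ n * fact n ^ n) = (- 1) ^ n * (?L * fact n ^ n)] (mod int p)"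
    using L by (intro cong_scalar_left cong_scalar_right)
  finally have *: "[(- 1) ^ (n div 2) * fact (n - 1) ^ n =
      (- 1) ^ (n div 2) * ((- 1) ^ n * (?L * fact n ^ n))] (mod int p)"
    by (rule cong_scalar_left)
  have sq: "[((fact n)\<^sup>2) ^ m = ((- 1) ^ Suc n) ^ m] (mod int p)" for m
    by (rule cong_pow [OF fact_half_square_cong [OF assms]])
  show ?thesis
  proof (cases "even n")
    case True
    then obtain m where m: "n = 2 * m"
      by blast
    have "[(- 1) ^ m * (?L * ((fact n)\<^sup>2) ^ m) = (- 1) ^ m * (?L * ((- 1) ^ Suc n) ^ m)] (mod int p)"
      by (intro cong_scalar_left sq)
    also have "(- 1) ^ m * (?L * ((- 1) ^ Suc n) ^ m) = ?L"
      using True by (simp add: ac_simps)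
    finally show ?thesis
      using * True by (auto simp: m power_mult intro: cong_trans)
  next
    case False
    then obtain m where m: "n = 2 * m + 1"
      by (elim oddE)
    \<comment> \<open>For odd n the symbol must cancel against the remaining signs, so its explicit
      value is needed.\<close>
    have L': "?L = (- 1) ^ Suc m"
      using Legendre_2 [OF assms] by (simp add: m)
    have "[- ((- 1) ^ m * ?L) * fact n * ((fact n)\<^sup>2) ^ m =
        - ((- 1) ^ m * ?L) * fact n * ((- 1) ^ Suc n) ^ m] (mod int p)"
      by (intro cong_scalar_left sq)
    also have "- ((- 1) ^ m * ?L) * fact n * ((- 1) ^ Suc n) ^ m = fact n"
      using False by (simp add: L')
    also have "- ((- 1) ^ m * ?L) * fact n * ((fact n)\<^sup>2) ^ m =
        (- 1) ^ (n div 2) * ((- 1) ^ n * (?L * fact n ^ n))"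
    proof -
      \<comment> \<open>A general \<open>F\<close> keeps the factorial intact when n is rewritten as
        2 m + 1.\<close>
      have "- ((- 1) ^ m * ?L) * F * (F\<^sup>2) ^ m = (- 1) ^ (n div 2) * ((- 1) ^ n * (?L * F ^ n))"
        for F :: int
        by (simp add: m power_mult [of F 2] mult.assoc mult.left_commute)
      then show ?thesis .
    qed
    finally show ?thesis
      using * False by (auto intro: cong_trans)
  qed
qed

lemma det_Legendre_cong:
  assumes "prime p" "p = 2 * n + 1"
  shows "rat_cong (det_from_1 n (\<lambda>i j. of_int (Legendre (int (i + j)) (int p)) / of_nat (i + j)))
    (of_int (if even n then Legendre 2 (int p) else fact n)) p"
proof -
  have n: "n > 0" "2 < p"
    using prime_ge_2_nat [OF assms(1)] assms(2) by presburger+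
  have "rat_cong (of_int (Legendre (int (Suc i + Suc j)) (int p)) / of_nat (Suc i + Suc j))
      (of_int ((int (Suc i) + int (Suc j)) ^ (n - 1))) p" if "i < n" "j < n" for i j
  proof -
    let ?s = "Suc i + Suc j"
    have "\<not> p dvd ?s"
      using that assms(2) by (intro nat_dvd_not_less) auto
    then have "coprime (int ?s) (int p)"
      unfolding coprime_int_iff using assms(1) by (metis coprime_commute prime_imp_coprime)
    \<comment> \<open>Euler's criterion gives s^n; one factor s is split off to cancel the
      denominator.\<close>
    moreover have "[Legendre (int ?s) (int p) = int ?s * int ?s ^ (n - 1)] (mod int p)"
      using euler_criterion [OF assms(1) n(2), of "int ?s"] n(1) assms(2)
      unfolding power_Suc [symmetric] by simp
    ultimately show ?thesis
      using rat_cong_divide_of_int [of "Legendre (int ?s) (int p)" "int ?s" "int ?s ^ (n - 1)" p]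
      by (simp only: of_int_of_nat_eq of_nat_add) simp
  qed
  then have "rat_cong (det_from_1 n
      (\<lambda>i j. of_int (Legendre (int (i + j)) (int p)) / of_nat (i + j)))
      (of_int (det (mat n n (\<lambda>(i, j). (int (Suc i) + int (Suc j)) ^ (n - 1))))) p"
    unfolding det_from_1_def by (rule rat_cong_det)
  also have "rat_cong (of_int (det (mat n n (\<lambda>(i, j). (int (Suc i) + int (Suc j)) ^ (n - 1)))))
      (of_int (if even n then Legendre 2 (int p) else fact n)) p"
    unfolding det_power_sum by (rule rat_cong_of_int [OF det_power_sum_cong [OF assms]])
  finally show ?thesis .
qed

section \<open>Part (ii): reciprocals of sums of two squares\<close>

text \<open>Factor each difference of squares: the differences give i!, the sums run through i + 2,
  ..., 2 i + 1, and the extra factor i + 1 closes the gap.\<close>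

lemma prod_square_diff:
  "int (Suc i) * (\<Prod>m<i. int (Suc i) ^ 2 - int (Suc m) ^ 2) = fact (2 * i + 1)"
proof -
  have "(\<Prod>m<k. int (i + m + 2)) * fact (Suc i) = fact (Suc i + k)" for k
    by (induction k) (simp_all add: algebra_simps)
  moreover have i: "Suc i + i = 2 * i + 1"
    by simp
  ultimately have "int (Suc i) * ((\<Prod>m<i. int (i + m + 2)) * fact i) = fact (2 * i + 1)"
    by (metis fact_Suc mult.assoc mult.commute)
  moreover have "(\<Prod>m<i. int (Suc i) ^ 2 - int (Suc m) ^ 2) =
      (\<Prod>m<i. int (i + m + 2) * (int i - int m))"
    by (intro prod.cong) (auto simp: algebra_simps power2_eq_square)
  ultimately show ?thesis
    by (simp only: prod.distrib prod_diff_from_below)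
qed

text \<open>Multiplied by n!, the product becomes 1! 3! ... (2 n - 1)!. Reversing the order turns (2
  i + 1)! into (p - 2 - 2 i)!, so in the square each pair is 1 modulo p by Wilson's theorem. Finally
  (n!)^2 is 1 since n is odd.\<close>

lemma vandermonde_squares_cong:
  assumes "prime p" "p = 2 * n + 1" "odd n"
  shows "[(\<Prod>i<n. \<Prod>m<i. int (Suc i) ^ 2 - int (Suc m) ^ 2)\<^sup>2 = 1] (mod int p)"
proof -
  let ?V = "\<Prod>i<n. \<Prod>m<i. int (Suc i) ^ 2 - int (Suc m) ^ 2"
  have "fact n * ?V = (\<Prod>i<n. fact (2 * i + 1))"
    unfolding fact_prod_Suc atLeast0LessThan of_nat_prod prod.distrib [symmetric] prod_square_diff ..
  moreover have "(\<Prod>i<n. fact (2 * i + 1) :: int) = (\<Prod>i<n. fact (p - Suc (2 * i + 1)))"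
  proof (subst prod.nat_diff_reindex [symmetric], intro prod.cong refl)
    fix i assume "i \<in> {..<n}"
    then have "2 * (n - Suc i) + 1 = p - Suc (2 * i + 1)"
      by (simp add: assms(2))
    then show "fact (2 * (n - Suc i) + 1) = (fact (p - Suc (2 * i + 1)) :: int)"
      by simp
  qed
  ultimately have "(fact n * ?V)\<^sup>2 = (\<Prod>i<n. fact (2 * i + 1) * fact (p - Suc (2 * i + 1)))"
    by (simp only: power2_eq_square prod.distrib)
  also have "[\<dots> = (\<Prod>i<n. (- 1) ^ Suc (2 * i + 1))] (mod int p)"
    using assms by (intro cong_prod fact_mult_fact_cong) auto
  finally have "[(fact n)\<^sup>2 * ?V\<^sup>2 = 1] (mod int p)"
    by (simp add: power_mult_distrib)
  moreover have "[1 * ?V\<^sup>2 = (fact n)\<^sup>2 * ?V\<^sup>2] (mod int p)"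
    using fact_half_square_cong [OF assms(1,2)] assms(3)
    by (intro cong_scalar_right) (simp add: cong_sym)
  ultimately show ?thesis
    using cong_trans by fastforce
qed

lemma det_inverse_squares_cong:
  assumes "prime p" "p = 2 * n + 1" "odd n"
  shows "rat_cong (det_from_1 n (\<lambda>i j. 1 / of_nat (i ^ 2 + j ^ 2))) (of_int (Legendre 2 (int p))) p"
proof -
  have n: "2 < p"
    using prime_ge_2_nat [OF assms(1)] assms(2) by presburger
  let ?x = "\<lambda>i. int (Suc i) ^ 2"
  let ?h = "int n + 1" \<comment> \<open>the inverse of 2 modulo \<open>p\<close>\<close>
  let ?L = "Legendre 2 (int p)"
  have half: "[2 * ?h = 1] (mod int p)"
    by (simp add: assms(2) cong_iff_dvd_diff)
  have x: "[?x i ^ n = 1] (mod int p)" if "i < n" for i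
  proof -
    have "\<not> p dvd Suc i"
      using that assms(2) by (intro nat_dvd_not_less) auto
    then have "[int (Suc i ^ (p - 1)) = int 1] (mod int p)"
      by (subst cong_int_iff) (rule fermat_theorem [OF assms(1)])
    then show ?thesis
      by (simp only: of_nat_power of_nat_1 power_mult [symmetric]) (simp add: assms(2))
  qed
  \<comment> \<open>The second family of points is -x_j: for odd n, x^n + y^n = x^n - (-y)^n is
    divisible by x + y as a difference of powers.\<close>
  have "rat_cong (1 / of_nat (Suc i ^ 2 + Suc j ^ 2))
      (of_int (\<Sum>k<n. ?h * ?x i ^ k * (- ?x j) ^ (n - Suc k))) p" if "i < n" "j < n" for i j
  proof -
    let ?b = "?x i + ?x j" and ?c = "\<Sum>k<n. ?h * ?x i ^ k * (- ?x j) ^ (n - Suc k)"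
    have "?b * ?c = ?h * ((?x i - - ?x j) * (\<Sum>k<n. (- ?x j) ^ (n - Suc k) * ?x i ^ k))"
      by (simp add: sum_distrib_left ac_simps)
    also have "\<dots> = ?h * (?x i ^ n + ?x j ^ n)"
      using assms(3) by (simp only: power_diff_sumr2 [symmetric]) simp
    also have "[\<dots> = ?h * (1 + 1)] (mod int p)"
      by (intro cong_scalar_left cong_add x that)
    also have "[?h * (1 + 1) = 1] (mod int p)"
      using half by (simp add: mult.commute)
    finally have *: "[1 = ?b * ?c] (mod int p)"
      by (rule cong_sym)
    \<comment> \<open>The denominator is a unit because \<open>?c\<close> is its inverse modulo p;
      no separate argument about sums of two squares is needed.\<close>
    have "coprime (?b * ?c) (int p)"
      by (rule cong_imp_coprime [OF *]) simp
    then have "coprime ?b (int p)"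
      by (simp only: coprime_mult_left_iff)
    moreover have "?b \<noteq> 0"
      by (simp add: add_nonneg_eq_0_iff)
    ultimately show ?thesis
      using rat_cong_divide_of_int [OF *] by simp
  qed
  then have "rat_cong (det_from_1 n (\<lambda>i j. 1 / of_nat (i ^ 2 + j ^ 2)))
      (of_int (det (mat n n (\<lambda>(i, j). \<Sum>k<n. ?h * ?x i ^ k * (- ?x j) ^ (n - Suc k))))) p"
    unfolding det_from_1_def by (rule rat_cong_det)
  \<comment> \<open>The negated points turn the reversed differences into the original ones, so the
    square appears without a sign.\<close>
  also have "det (mat n n (\<lambda>(i, j). \<Sum>k<n. ?h * ?x i ^ k * (- ?x j) ^ (n - Suc k))) =
      ?h ^ n * (\<Prod>i<n. \<Prod>m<i. ?x i - ?x m)\<^sup>2"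
    by (subst det_homogeneous_sum) (simp add: power2_eq_square)
  also have "rat_cong (of_int (?h ^ n * (\<Prod>i<n. \<Prod>m<i. ?x i - ?x m)\<^sup>2)) (of_int ?L) p"
  proof (rule rat_cong_of_int)
    have "[?h ^ n * (\<Prod>i<n. \<Prod>m<i. ?x i - ?x m)\<^sup>2 = ?h ^ n * 1] (mod int p)"
      by (intro cong_scalar_left vandermonde_squares_cong assms)
    \<comment> \<open>The symbol squares to 1; one copy then becomes 2^n and absorbs
      \<open>?h ^ n\<close>.\<close>
    also have "?h ^ n * 1 = ?L * ?h ^ n * ?L"
      by (simp add: Legendre_2 [OF assms(1,2)])
    also have "[\<dots> = ?L * ?h ^ n * 2 ^ n] (mod int p)"
      using euler_criterion [OF assms(1) n, of 2] assms(2) by (intro cong_scalar_left) simp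
    also have "?L * ?h ^ n * 2 ^ n = ?L * (2 * ?h) ^ n"
      by (simp only: power_mult_distrib ac_simps)
    also have "[\<dots> = ?L * 1 ^ n] (mod int p)"
      by (intro cong_scalar_left cong_pow half)
    finally show "[?h ^ n * (\<Prod>i<n. \<Prod>m<i. ?x i - ?x m)\<^sup>2 = ?L] (mod int p)"
      by simp
  qed
  finally show ?thesis .
qed

theorem theorem1p3:
  shows "(\<forall>p::nat. prime p \<and> odd p \<longrightarrow>
            rat_cong
              (det_from_1 ((p - 1) div 2)
                 (\<lambda>i j. of_int (Legendre (int (i + j)) (int p)) / of_nat (i + j)))
              (if [p = 1] (mod 4) then of_int (Legendre 2 (int p))
               else fact ((p - 1) div 2))
              p)
       \<and> (\<forall>p::nat. prime p \<and> [p = 3] (mod 4) \<longrightarrow>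
            rat_cong
              (det_from_1 ((p - 1) div 2) (\<lambda>i j. 1 / of_nat (i ^ 2 + j ^ 2)))
              (of_int (Legendre 2 (int p)))
              p)"
proof (intro conjI allI impI)
  fix p :: nat
  assume p: "prime p \<and> odd p"
  define n where "n = (p - 1) div 2"
  have n: "p = 2 * n + 1"
    using p by (auto simp: n_def elim: oddE)
  have "[p = 1] (mod 4) \<longleftrightarrow> even n"
    unfolding n cong_def by presburger
  then show "rat_cong
      (det_from_1 ((p - 1) div 2)
         (\<lambda>i j. of_int (Legendre (int (i + j)) (int p)) / of_nat (i + j)))
      (if [p = 1] (mod 4) then of_int (Legendre 2 (int p)) else fact ((p - 1) div 2)) p"
    using det_Legendre_cong [of p n] p n by (simp add: n_def [symmetric] split: if_splits)
next
  fix p :: nat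
  assume p: "prime p \<and> [p = 3] (mod 4)"
  then have "p mod 4 = 3"
    by (simp add: cong_def)
  then have "p = 2 * ((p - 1) div 2) + 1" "odd ((p - 1) div 2)"
    by presburger+
  then show "rat_cong
      (det_from_1 ((p - 1) div 2) (\<lambda>i j. 1 / of_nat (i ^ 2 + j ^ 2)))
      (of_int (Legendre 2 (int p))) p"
    using p by (intro det_inverse_squares_cong) auto
qed

end
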